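(* Let $0<p<q<\infty$ and $s\in(0,1)$. If $u\in (B^{s}_{p,\infty})_w(\mathbb{R}^N)\cap VMO(\mathbb{R}^N)$, then $$\lim_{h\to0}\int_{\mathbb{R}^N}\frac{|u(x+h)-u(x)|^q}{|h|^{sp}}\,dx=0 .$$
   Context: $\mathcal{L}^N$ is Lebesgue measure. $[f]_{L^p_w(\mathbb{R}^N)}:=\left[\sup_{t>0}t\,\mathcal{L}^N(\{|f|^p>t\})\right]^{1/p}$, and $L^p_w(\mathbb{R}^N)$ is the set of measurable $f$ for which it is finite. For $s\in(0,1)$, $u\in(B^s_{p,\infty})_w(\mathbb{R}^N)$ means that $u\in L^p_w(\mathbb{R}^N)$ and $$\sup_{0<t<\infty}t^{-s}\sup_{|h|\le t}[u(\cdot+h)-u]_{L^p_w(\mathbb{R}^N)}<\infty .$$ A cube is a Cartesian product of $N$ non-empty closed bounded intervals of the same (positive) length. For real-valued $u\in L^1_{\mathrm{loc}}(\mathbb{R}^N)$, $u\in BMO(\mathbb{R}^N)$ means that $\sup_C \frac{1}{\mathcal{L}^N(C)^2}\int_C\int_C|u(z)-u(x)|\,dz\,dx<\infty$, the supremum being over all cubes $C\subset\mathbb{R}^N$. $VMO(\mathbb{R}^N)$ is the set of $u\in BMO(\mathbb{R}^N)$ with $$\lim_{R\to0^+}\ \sup_{C\text{ cube},\ \operatorname{diam}(C)\le R}\ \frac{1}{\mathcal{L}^N(C)^2}\int_C\int_C|u(x)-u(z)|\,dx\,dz=0 .$$ *)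

theory Defs
  imports "HOL-Analysis.Analysis"
begin

text \<open>
  All suprema and integrals below are taken in \<^typ>\<open>ennreal\<close>, so that infinite values
  are represented and finiteness is a genuine condition. The library has no real power on
  \<^typ>\<open>ennreal\<close>; the case distinction provides it, with the value \<open>top\<close> at \<open>top\<close>.
\<close>

definition weak_Lp_seminorm :: "real \<Rightarrow> (real ^ 'n \<Rightarrow> real) \<Rightarrow> ennreal" where
  "weak_Lp_seminorm p f =
     (let S = (SUP t\<in>{0<..}. ennreal t * emeasure lebesgue {x. \<bar>f x\<bar> powr p > t})
      in if S = top then top else ennreal (enn2real S powr (1 / p)))"

definition weak_Lp :: "real \<Rightarrow> (real ^ 'n \<Rightarrow> real) set" where
  "weak_Lp p = {f. f \<in> borel_measurable lebesgue \<and> weak_Lp_seminorm p f < top}"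

definition weak_Besov :: "real \<Rightarrow> real \<Rightarrow> (real ^ 'n \<Rightarrow> real) set" where
  "weak_Besov s p = {u. u \<in> weak_Lp p \<and>
     (SUP t\<in>{0<..}. ennreal (t powr (- s)) *
        (SUP h\<in>{h. norm h \<le> t}. weak_Lp_seminorm p (\<lambda>x. u (x + h) - u x))) < top}"

definition is_cube :: "(real ^ 'n) set \<Rightarrow> bool" where
  "is_cube C \<longleftrightarrow> (\<exists>a b l. 0 < l \<and> (\<forall>i. b $ i - a $ i = l) \<and> C = cbox a b)"

definition L1_loc :: "(real ^ 'n \<Rightarrow> real) set" where
  "L1_loc = {u. \<forall>K. compact K \<longrightarrow> set_integrable lebesgue K u}"

definition mean_osc :: "(real ^ 'n \<Rightarrow> real) \<Rightarrow> (real ^ 'n) set \<Rightarrow> ennreal" where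
  "mean_osc u C =
     (\<integral>\<^sup>+x\<in>C. (\<integral>\<^sup>+z\<in>C. ennreal \<bar>u z - u x\<bar> \<partial>lebesgue) \<partial>lebesgue) / (emeasure lebesgue C)\<^sup>2"

definition BMO :: "(real ^ 'n \<Rightarrow> real) set" where
  "BMO = {u. u \<in> L1_loc \<and> (SUP C\<in>{C. is_cube C}. mean_osc u C) < top}"

definition VMO :: "(real ^ 'n \<Rightarrow> real) set" where
  "VMO = {u. u \<in> BMO \<and>
     ((\<lambda>R. SUP C\<in>{C. is_cube C \<and> diameter C \<le> R}. mean_osc u C) \<longlongrightarrow> 0) (at_right 0)}"

end

theory Submission
  imports Defs "HOL-Real_Asymp.Real_Asymp"
begin

text \<open>
  Write \<open>f x = u (x + h) - u x\<close>. The weak Besov bound controls the level sets by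
  \<open>|{|f| > t}| \<le> A |h|^(s p) / t^p\<close>, which suffices for the part of the integral where \<open>|f| \<le> 2 d\<close>.
  For the large values, fix a small scale \<open>r\<close>. Once \<open>h\<close> is small, \<open>{|f| > d}\<close> has low density in
  every cube of side \<open>r\<close>, so for each \<open>t \<ge> d\<close> the set \<open>{|f| > t}\<close> is covered up to a null set by
  disjoint dyadic cubes of side below \<open>r\<close> in which its density is at least \<open>2^(-N-1)\<close> and at most
  \<open>1/2\<close>. In such a cube the oscillation of \<open>f\<close>, small by VMO, bounds \<open>|{|f| > t + d}|\<close>, and summation
  gives \<open>2 |{|f| > t + d}| \<le> |{|f| > t}|\<close>. This geometric decay makes the whole integral at most
  \<open>C A |h|^(s p) d^(q - p)\<close>, and \<open>d\<close> is arbitrary.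
\<close>

section \<open>Dyadic stopping cells\<close>

text \<open>Half-open cubes of side \<open>r / 2 ^ k\<close> on a grid anchored at the origin.
  Naming a cell by a member point and comparing floors makes membership an equivalence relation, so
  the cells of one level partition the space exactly.\<close>

definition dyadic_cell :: "real \<Rightarrow> nat \<Rightarrow> real ^ 'n \<Rightarrow> (real ^ 'n) set" where
  "dyadic_cell r k x = {y. \<forall>i. \<lfloor>2 ^ k * (y $ i) / r\<rfloor> = \<lfloor>2 ^ k * (x $ i) / r\<rfloor>}"

lemma self_in_dyadic_cell: "x \<in> dyadic_cell r k x"
  by (simp add: dyadic_cell_def)

lemma dyadic_cell_eq: "y \<in> dyadic_cell r k x \<Longrightarrow> dyadic_cell r k y = dyadic_cell r k x"
  by (auto simp: dyadic_cell_def)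

text \<open>Nesting is read off the grid index: at level \<open>j\<close> it is the integer quotient
  of the index at level \<open>k\<close> by \<open>2 ^ (k - j)\<close>.\<close>

lemma dyadic_cell_antimono:
  assumes "j \<le> k"
  shows "dyadic_cell r k x \<subseteq> dyadic_cell r j x"
proof
  fix y assume y: "y \<in> dyadic_cell r k x"
  have *: "\<lfloor>2 ^ j * t / r\<rfloor> = \<lfloor>2 ^ k * t / r\<rfloor> div 2 ^ (k - j)" for t :: real
  proof -
    have "2 ^ k = (2 ^ j * 2 ^ (k - j) :: real)"
      using assms by (simp flip: power_add)
    then have "2 ^ j * t / r = (2 ^ k * t / r) / real_of_int (2 ^ (k - j))"
      by simp
    then show ?thesis
      using floor_divide_real_eq_div[of "2 ^ (k - j)" "2 ^ k * t / r"] by simp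
  qed
  show "y \<in> dyadic_cell r j x"
    using y by (simp add: dyadic_cell_def *)
qed

lemma dyadic_cell_eq_le:
  assumes "y \<in> dyadic_cell r k x" "j \<le> k"
  shows "dyadic_cell r j y = dyadic_cell r j x"
  using assms dyadic_cell_antimono dyadic_cell_eq by blast

text \<open>Oscillation is controlled on closed cubes, while cells are half-open. Squeezing a cell
  between an open and a closed box gives its measure and later lets the closed cube replace
  it.\<close>

lemma dyadic_cell_between_boxes:
  fixes x :: "real ^ 'n"
  assumes "0 < r"
  obtains a b where "\<And>i. b $ i - a $ i = r / 2 ^ k" "box a b \<subseteq> dyadic_cell r k x"
    "dyadic_cell r k x \<subseteq> cbox a b"
proof
  define m where "m i = \<lfloor>2 ^ k * (x $ i) / r\<rfloor>" for i
  define a b :: "real ^ 'n"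
    where "a = (\<chi> i. of_int (m i) * r / 2 ^ k)" and "b = (\<chi> i. (of_int (m i) + 1) * r / 2 ^ k)"
  show "b $ i - a $ i = r / 2 ^ k" for i
    by (simp add: a_def b_def field_simps)
  have cell: "y \<in> dyadic_cell r k x \<longleftrightarrow>
      (\<forall>i. of_int (m i) * r / 2 ^ k \<le> y $ i \<and> y $ i < (of_int (m i) + 1) * r / 2 ^ k)" for y
  proof -
    have "y \<in> dyadic_cell r k x \<longleftrightarrow> (\<forall>i. \<lfloor>2 ^ k * (y $ i) / r\<rfloor> = m i)"
      by (simp add: dyadic_cell_def m_def)
    then show ?thesis
      using assms by (simp add: floor_eq_iff field_simps)
  qed
  show "box a b \<subseteq> dyadic_cell r k x" "dyadic_cell r k x \<subseteq> cbox a b"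
    by (auto simp: cell subset_iff mem_box_cart a_def b_def intro: less_imp_le)
qed

lemma dyadic_cell_borel [measurable]: "dyadic_cell r k x \<in> sets borel"
proof -
  have "dyadic_cell r k x = (\<Inter>i. {y. \<lfloor>2 ^ k * (y $ i) / r\<rfloor> = \<lfloor>2 ^ k * (x $ i) / r\<rfloor>})"
    by (auto simp: dyadic_cell_def)
  also have "\<dots> \<in> sets borel"
    by (intro sets.countable_INT) (auto simp: floor_eq_iff)
  finally show ?thesis .
qed

lemma emeasure_cube:
  fixes a b :: "real ^ 'n"
  assumes "0 \<le> l" "\<And>i. b $ i - a $ i = l"
  shows "emeasure lborel (cbox a b) = ennreal (l ^ CARD('n))"
    and "emeasure lborel (box a b) = ennreal (l ^ CARD('n))"
proof -
  have "a $ i \<le> b $ i" for i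
    using assms(1) assms(2)[of i] by linarith
  then have "cbox a b \<noteq> {}"
    by (simp add: interval_ne_empty_cart)
  then have *: "measure lborel (cbox a b) = l ^ CARD('n)"
    using assms by (simp add: content_cbox_cart)
  show "emeasure lborel (cbox a b) = ennreal (l ^ CARD('n))"
    using * emeasure_lborel_cbox_finite[of a b] by (simp add: emeasure_eq_ennreal_measure less_top)
  then show "emeasure lborel (box a b) = ennreal (l ^ CARD('n))"
    by (simp add: emeasure_lborel_box_eq emeasure_lborel_cbox_eq)
qed

lemma emeasure_dyadic_cell:
  fixes x :: "real ^ 'n"
  assumes "0 < r"
  shows "emeasure lebesgue (dyadic_cell r k x) = ennreal ((r / 2 ^ k) ^ CARD('n))"
proof -
  obtain a b where ab: "\<And>i. b $ i - a $ i = r / 2 ^ k" "box a b \<subseteq> dyadic_cell r k x"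
    "dyadic_cell r k x \<subseteq> cbox a b"
    using dyadic_cell_between_boxes[OF assms, of k x] by metis
  have "emeasure lborel (box a b) \<le> emeasure lborel (dyadic_cell r k x)"
    "emeasure lborel (dyadic_cell r k x) \<le> emeasure lborel (cbox a b)"
    using ab by (auto intro!: emeasure_mono)
  then show ?thesis
    using emeasure_cube[of "r / 2 ^ k" b a] ab(1) assms by simp
qed

text \<open>The l1 norm dominates the Euclidean norm, whence the factor \<open>CARD('n)\<close>.
  Only the decay to 0 in \<open>k\<close> matters here.\<close>

lemma dist_dyadic_cell_le:
  fixes x :: "real ^ 'n"
  assumes "0 < r" "y \<in> dyadic_cell r k x"
  shows "dist y x \<le> real CARD('n) * (r / 2 ^ k)"
proof -
  obtain a b :: "real ^ 'n" where ab: "\<And>i. b $ i - a $ i = r / 2 ^ k"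
    "dyadic_cell r k x \<subseteq> cbox a b"
    using dyadic_cell_between_boxes[OF assms(1)] by metis
  then have "x \<in> cbox a b" "y \<in> cbox a b"
    using assms(2) self_in_dyadic_cell by blast+
  then have "\<bar>(y - x) $ i\<bar> \<le> r / 2 ^ k" for i
    unfolding mem_box_cart using ab(1)[of i] by (smt (verit) vector_minus_component)
  then have "(\<Sum>i\<in>UNIV. \<bar>(y - x) $ i\<bar>) \<le> (\<Sum>i\<in>(UNIV::'n set). r / 2 ^ k)"
    by (intro sum_mono) auto
  then show ?thesis
    using norm_le_l1_cart[of "y - x"] by (simp add: dist_norm)
qed

lemma dyadic_cell_in_open:
  fixes x :: "real ^ 'n"
  assumes "0 < r" "open U" "x \<in> U"
  obtains k where "dyadic_cell r k x \<subseteq> U"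
proof -
  obtain e where e: "0 < e" "ball x e \<subseteq> U"
    using assms openE by blast
  have "(\<lambda>k. real CARD('n) * r * (1 / 2) ^ k) \<longlonglongrightarrow> real CARD('n) * r * 0"
    by (intro tendsto_intros LIMSEQ_realpow_zero) auto
  then have "eventually (\<lambda>k. real CARD('n) * r * (1 / 2) ^ k < e) sequentially"
    using e(1) by (intro order_tendstoD) auto
  then obtain k where "real CARD('n) * r * (1 / 2) ^ k < e"
    using eventually_happens'[OF sequentially_bot] by blast
  then have "dyadic_cell r k x \<subseteq> ball x e"
    using dist_dyadic_cell_le[OF assms(1), of _ k x]
    by (force simp: power_one_over dist_commute)
  then show thesis
    using that e by blast
qed

section \<open>Maximal cells and the Calderon-Zygmund stopping argument\<close>

text \<open>Around each point, stop at the coarsest level at which \<open>P\<close> holds. This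
  level is constant on each chosen cell, so chosen cells that meet coincide.\<close>

lemma maximal_dyadic_cells:
  fixes P :: "(real ^ 'n) set \<Rightarrow> bool"
  assumes "0 < r"
  obtains \<Q> where "countable \<Q>" "disjoint \<Q>" "\<Union>\<Q> = {x. \<exists>k. P (dyadic_cell r k x)}"
    "\<And>Q. Q \<in> \<Q> \<Longrightarrow>
      \<exists>k x. Q = dyadic_cell r k x \<and> P Q \<and> (\<forall>j<k. \<not> P (dyadic_cell r j x))"
proof
  define K where "K x = (LEAST k. P (dyadic_cell r k x))" for x
  define G where "G = {x. \<exists>k. P (dyadic_cell r k x)}"
  define \<Q> where "\<Q> = (\<lambda>x. dyadic_cell r (K x) x) ` G"
  have PK: "P (dyadic_cell r (K x) x)" if "x \<in> G" for x
    using that unfolding G_def K_def by (auto intro: LeastI)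
  have not_PK: "\<not> P (dyadic_cell r j x)" if "j < K x" for j x
    using that not_less_Least unfolding K_def by blast
  have K_eq: "K z = K x" "z \<in> G" if "x \<in> G" "z \<in> dyadic_cell r (K x) x" for x z
  proof -
    \<comment> \<open>Up to the stopping level, the cells around \<open>z\<close> and
      \<open>x\<close> agree, so the same levels are rejected and the same one is accepted for both
      points.\<close>
    have *: "dyadic_cell r j z = dyadic_cell r j x" if "j \<le> K x" for j
      using dyadic_cell_eq_le \<open>z \<in> dyadic_cell r (K x) x\<close> that by blast
    have "P (dyadic_cell r (K x) z)"
      using *[of "K x"] PK[OF \<open>x \<in> G\<close>] by simp
    then show "z \<in> G"
      unfolding G_def by blast
    show "K z = K x"
      unfolding K_def[of z]
    proof (rule Least_equality)
      show "P (dyadic_cell r (K x) z)"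
        using *[of "K x"] PK[OF \<open>x \<in> G\<close>] by simp
      show "K x \<le> j" if "P (dyadic_cell r j z)" for j
        using *[of j] not_PK[of j x] that by (cases "j < K x") auto
    qed
  qed
  show disj: "disjoint \<Q>"
  proof (rule disjointI)
    fix S T assume "S \<in> \<Q>" "T \<in> \<Q>" "S \<noteq> T"
    then obtain x y where xy: "x \<in> G" "y \<in> G" "S = dyadic_cell r (K x) x" "T = dyadic_cell r (K y) y"
      by (auto simp: \<Q>_def)
    show "S \<inter> T = {}"
    proof (rule ccontr)
      assume "S \<inter> T \<noteq> {}"
      then obtain z where "z \<in> S" "z \<in> T" by blast
      then have "S = T"
        using xy K_eq dyadic_cell_eq by metis
      then show False using \<open>S \<noteq> T\<close> by simp
    qed
  qed
  show "\<Union>\<Q> = {x. \<exists>k. P (dyadic_cell r k x)}"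
    unfolding G_def[symmetric] \<Q>_def using K_eq(2) self_in_dyadic_cell by blast
  show "\<exists>k x. Q = dyadic_cell r k x \<and> P Q \<and> (\<forall>j<k. \<not> P (dyadic_cell r j x))" if "Q \<in> \<Q>" for Q
    using that PK not_PK unfolding \<Q>_def by blast
  \<comment> \<open>Disjoint sets with non-empty interior form a countable family.\<close>
  have "interior Q \<noteq> {}" if "Q \<in> \<Q>" for Q
  proof -
    obtain k x where Q: "Q = dyadic_cell r k x"
      using \<open>Q \<in> \<Q>\<close> by (auto simp: \<Q>_def)
    obtain a b where ab: "\<And>i. b $ i - a $ i = r / 2 ^ k" "box a b \<subseteq> Q"
      using dyadic_cell_between_boxes[OF assms] Q by metis
    have "a $ i < b $ i" for i
    proof -
      have "0 < r / 2 ^ k" using assms by simp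
      then show ?thesis using ab(1)[of i] by linarith
    qed
    then have "box a b \<noteq> {}"
      by (simp add: interval_ne_empty_cart)
    then show ?thesis
      using ab(2) interior_maximal[OF _ open_box] by blast
  qed
  then show "countable \<Q>"
    using disj by (intro countable_disjoint_nonempty_interior_subsets) auto
qed

lemma emeasure_disjoint_countable_Union:
  assumes "countable \<Q>" "disjoint \<Q>" "\<And>Q. Q \<in> \<Q> \<Longrightarrow> Q \<in> sets M" "E \<in> sets M"
  shows "emeasure M (E \<inter> \<Union>\<Q>) = (\<integral>\<^sup>+Q. emeasure M (E \<inter> Q) \<partial>count_space \<Q>)"
proof -
  have "E \<inter> \<Union>\<Q> = \<Union>((\<inter>) E ` \<Q>)" by auto
  moreover have "disjoint_family_on ((\<inter>) E) \<Q>"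
    using assms(2) by (fastforce simp: disjoint_family_on_def disjoint_def)
  ultimately show ?thesis
    using emeasure_UN_countable[of \<Q> "(\<inter>) E" M] assms by auto
qed

text \<open>Outer regularity replaces the Lebesgue density theorem: an open set only slightly larger
  than \<open>Z\<close> is tiled by cells, each of which \<open>Z\<close> fills to at most the proportion \<open>c\<close>.\<close>

lemma null_if_low_density:
  fixes Z :: "(real ^ 'n) set"
  assumes "0 < r" "Z \<in> sets lebesgue" "emeasure lebesgue Z < top" "0 < c" "c < 1"
    and dens: "\<And>k x. x \<in> Z \<Longrightarrow>
      emeasure lebesgue (Z \<inter> dyadic_cell r k x) \<le> ennreal c * emeasure lebesgue (dyadic_cell r k x)"
  shows "emeasure lebesgue Z = 0"
proof (rule ccontr)
  assume nz: "emeasure lebesgue Z \<noteq> 0"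
  define m where "m = measure lebesgue Z"
  have m: "emeasure lebesgue Z = ennreal m"
    using assms(3) by (simp add: m_def emeasure_eq_ennreal_measure less_top)
  with nz have "0 < m"
    by (simp add: ennreal_eq_0_iff)
  \<comment> \<open>The excess \<open>(1 - c) * m\<close> is chosen so that the resulting inequality
    \<open>m \<le> c * (m + (1 - c) * m)\<close> fails: the two sides differ by
    \<open>(1 - c)\<^sup>2 * m\<close>, which is positive.\<close>
  obtain U where U: "open U" "Z \<subseteq> U" "U - Z \<in> lmeasurable"
      "emeasure lebesgue (U - Z) < ennreal ((1 - c) * m)"
    using sets_lebesgue_outer_open[OF assms(2), of "(1 - c) * m"] \<open>0 < m\<close> \<open>c < 1\<close> by auto
  \<comment> \<open>Requiring a cell to meet \<open>Z\<close> makes it a cell around a point of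
    \<open>Z\<close>, which is what \<open>dens\<close> asks for.\<close>
  obtain \<Q> where \<Q>: "countable \<Q>" "disjoint \<Q>" "\<Union>\<Q> = {x. \<exists>k. dyadic_cell r k x \<subseteq> U \<and> dyadic_cell r k x \<inter> Z \<noteq> {}}"
    "\<And>Q. Q \<in> \<Q> \<Longrightarrow> \<exists>k x. Q = dyadic_cell r k x \<and> (Q \<subseteq> U \<and> Q \<inter> Z \<noteq> {})"
    using maximal_dyadic_cells[OF assms(1), of "\<lambda>Q. Q \<subseteq> U \<and> Q \<inter> Z \<noteq> {}"] by (smt (verit))
  have Q_sets: "Q \<in> sets lebesgue" if "Q \<in> \<Q>" for Q
    using \<Q>(4)[OF that] dyadic_cell_borel by auto
  have U_sets: "U \<in> sets lebesgue"
    using U(1) by auto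
  have "Z \<subseteq> \<Union>\<Q>"
  proof
    fix x assume "x \<in> Z"
    then obtain k where "dyadic_cell r k x \<subseteq> U"
      using dyadic_cell_in_open[OF assms(1) U(1)] U(2) by blast
    then show "x \<in> \<Union>\<Q>"
      using \<open>x \<in> Z\<close> self_in_dyadic_cell unfolding \<Q>(3) by blast
  qed
  then have "emeasure lebesgue Z = emeasure lebesgue (Z \<inter> \<Union>\<Q>)"
    by (simp add: Int_absorb2)
  also have "\<dots> = (\<integral>\<^sup>+Q. emeasure lebesgue (Z \<inter> Q) \<partial>count_space \<Q>)"
    using \<Q> Q_sets assms(2) by (intro emeasure_disjoint_countable_Union) auto
  also have "\<dots> \<le> (\<integral>\<^sup>+Q. ennreal c * emeasure lebesgue (U \<inter> Q) \<partial>count_space \<Q>)"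
  proof (rule nn_integral_mono)
    fix Q assume "Q \<in> space (count_space \<Q>)"
    then have "Q \<in> \<Q>" by simp
    then obtain k x where Q: "Q = dyadic_cell r k x" "Q \<subseteq> U" "Q \<inter> Z \<noteq> {}"
      using \<Q>(4) by blast
    then obtain z where z: "z \<in> Q" "z \<in> Z" by blast
    then have "Q = dyadic_cell r k z"
      using Q dyadic_cell_eq by metis
    then show "emeasure lebesgue (Z \<inter> Q) \<le> ennreal c * emeasure lebesgue (U \<inter> Q)"
      using dens[OF z(2), of k] Q(2) by (simp add: Int_absorb1)
  qed
  also have "\<dots> = ennreal c * emeasure lebesgue (U \<inter> \<Union>\<Q>)"
    by (subst emeasure_disjoint_countable_Union[OF \<Q>(1,2) Q_sets U_sets])
      (auto simp: nn_integral_cmult)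
  also have "\<dots> \<le> ennreal c * emeasure lebesgue U"
    using U_sets by (intro mult_left_mono emeasure_mono) auto
  also have "emeasure lebesgue U = emeasure lebesgue Z + emeasure lebesgue (U - Z)"
    using U(2) U_sets assms(2) by (subst plus_emeasure) (auto simp: Un_absorb1)
  also have "ennreal c * \<dots> \<le> ennreal c * (ennreal m + ennreal ((1 - c) * m))"
    using U(4) m by (intro mult_left_mono add_mono) auto
  also have "\<dots> = ennreal (c * (m + (1 - c) * m))"
    using \<open>0 < m\<close> \<open>0 < c\<close> \<open>c < 1\<close> by (simp add: ennreal_mult ennreal_plus)
  finally have "m \<le> c * (m + (1 - c) * m)"
    using m \<open>0 < m\<close> \<open>0 < c\<close> \<open>c < 1\<close> by simp
  moreover have "m - c * (m + (1 - c) * m) = (1 - c)\<^sup>2 * m"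
    by (simp add: algebra_simps power2_eq_square)
  moreover have "0 < (1 - c)\<^sup>2 * m"
    using \<open>0 < m\<close> \<open>c < 1\<close> by simp
  ultimately show False by linarith
qed

text \<open>Stop at the first cell in which \<open>E\<close> has density above 2^(-N-1). By
  \<open>base\<close> this never happens at level 0, so a stopping cell has a parent of low density
  and itself has density at most 1/2; then \<open>local\<close> applies. The stopping density in
  turn bounds the measure of the cell by 2^(N+1) times that of its part of \<open>E\<close>, and the
  cells are disjoint.\<close>

lemma emeasure_le_by_stopping_cells:
  fixes E F :: "(real ^ 'n) set"
  assumes "0 < r" "E \<in> sets lebesgue" "F \<in> sets lebesgue" "F \<subseteq> E" "emeasure lebesgue E < top"
    and base: "\<And>x. 2 ^ (CARD('n) + 1) * emeasure lebesgue (E \<inter> dyadic_cell r 0 x)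
                \<le> emeasure lebesgue (dyadic_cell r 0 x)"
    and local: "\<And>k x. 2 * emeasure lebesgue (E \<inter> dyadic_cell r k x) \<le> emeasure lebesgue (dyadic_cell r k x)
       \<Longrightarrow> emeasure lebesgue (F \<inter> dyadic_cell r k x) \<le> c * emeasure lebesgue (dyadic_cell r k x)"
  shows "emeasure lebesgue F \<le> c * 2 ^ (CARD('n) + 1) * emeasure lebesgue E"
proof -
  let ?C = "2 ^ (CARD('n) + 1) :: ennreal"
  define P where "P Q \<longleftrightarrow> emeasure lebesgue Q < ?C * emeasure lebesgue (E \<inter> Q)"
    for Q :: "(real ^ 'n) set"
  obtain \<Q> where \<Q>: "countable \<Q>" "disjoint \<Q>" "\<Union>\<Q> = {x. \<exists>k. P (dyadic_cell r k x)}"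
    "\<And>Q. Q \<in> \<Q> \<Longrightarrow> \<exists>k x. Q = dyadic_cell r k x \<and> P Q \<and> (\<forall>j<k. \<not> P (dyadic_cell r j x))"
    using maximal_dyadic_cells[OF assms(1), of P] by blast
  have Q_sets: "Q \<in> sets lebesgue" if "Q \<in> \<Q>" for Q
    using \<Q>(4)[OF that] dyadic_cell_borel by auto
  have UQ: "\<Union>\<Q> \<in> sets lebesgue"
    using \<Q>(1) Q_sets by (intro sets.countable_Union) auto
  \<comment> \<open>Around a point of \<open>E\<close> outside all stopping cells, the density is at
    most 2^(-N-1) at every level.\<close>
  have "emeasure lebesgue (E - \<Union>\<Q>) = 0"
  proof (rule null_if_low_density[OF assms(1), where c = "1 / 2 ^ (CARD('n) + 1)"])
    show "emeasure lebesgue (E - \<Union>\<Q>) < top"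
      using assms(2,5) UQ emeasure_mono[of "E - \<Union>\<Q>" E lebesgue] by (auto intro: order.strict_trans1)
    have "(1::real) < 2 ^ (CARD('n) + 1)"
      by (rule one_less_power) auto
    then show "1 / 2 ^ (CARD('n) + 1) < (1::real)"
      by simp
    fix k x assume x: "x \<in> E - \<Union>\<Q>"
    let ?D = "dyadic_cell r k x"
    have D: "?D \<in> sets lebesgue"
      using dyadic_cell_borel by auto
    have inv: "ennreal (1 / 2 ^ (CARD('n) + 1)) * ?C = 1"
    proof -
      have "?C = ennreal (2 ^ (CARD('n) + 1))"
        by (metis ennreal_numeral ennreal_power zero_le_numeral)
      then show ?thesis
        by (simp flip: ennreal_mult'')
    qed
    have "?C * emeasure lebesgue (E \<inter> ?D) \<le> emeasure lebesgue ?D"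
      using x \<Q>(3) by (auto simp: P_def not_less)
    then have "ennreal (1 / 2 ^ (CARD('n) + 1)) * (?C * emeasure lebesgue (E \<inter> ?D))
        \<le> ennreal (1 / 2 ^ (CARD('n) + 1)) * emeasure lebesgue ?D"
      by (intro mult_left_mono) auto
    then have "emeasure lebesgue (E \<inter> ?D) \<le> ennreal (1 / 2 ^ (CARD('n) + 1)) * emeasure lebesgue ?D"
      by (simp only: mult.assoc[symmetric] inv mult_1_left)
    moreover have "emeasure lebesgue ((E - \<Union>\<Q>) \<inter> ?D) \<le> emeasure lebesgue (E \<inter> ?D)"
      using assms(2) D by (intro emeasure_mono) auto
    ultimately show "emeasure lebesgue ((E - \<Union>\<Q>) \<inter> ?D)
        \<le> ennreal (1 / 2 ^ (CARD('n) + 1)) * emeasure lebesgue ?D"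
      by (rule order.trans[rotated])
  qed (use assms(2) UQ in auto)
  then have "emeasure lebesgue (F - \<Union>\<Q>) = 0"
    using emeasure_mono[of "F - \<Union>\<Q>" "E - \<Union>\<Q>" lebesgue] assms(2,4) UQ by fastforce
  moreover have "emeasure lebesgue F = emeasure lebesgue (F \<inter> \<Union>\<Q>) + emeasure lebesgue (F - \<Union>\<Q>)"
    using assms(3) UQ by (subst plus_emeasure) (auto simp: Int_Diff_Un)
  ultimately have "emeasure lebesgue F = emeasure lebesgue (F \<inter> \<Union>\<Q>)"
    by simp
  also have "\<dots> = (\<integral>\<^sup>+Q. emeasure lebesgue (F \<inter> Q) \<partial>count_space \<Q>)"
    by (rule emeasure_disjoint_countable_Union[OF \<Q>(1,2) Q_sets assms(3)])
  also have "\<dots> \<le> (\<integral>\<^sup>+Q. c * ?C * emeasure lebesgue (E \<inter> Q) \<partial>count_space \<Q>)"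
  proof (rule nn_integral_mono)
    fix Q assume "Q \<in> space (count_space \<Q>)"
    then have "Q \<in> \<Q>" by simp
    then obtain k x where Q: "Q = dyadic_cell r k x" "P Q" "\<And>j. j < k \<Longrightarrow> \<not> P (dyadic_cell r j x)"
      using \<Q>(4) by blast
    have "\<not> P (dyadic_cell r 0 x)"
      using base[of x] by (simp add: P_def not_less)
    then obtain j where k: "k = Suc j"
      using Q(1,2) by (cases k) auto
    have parent: "emeasure lebesgue (dyadic_cell r j x) = 2 ^ CARD('n) * emeasure lebesgue Q"
    proof -
      have "(r / 2 ^ j) ^ CARD('n) = 2 ^ CARD('n) * (r / 2 ^ k) ^ CARD('n)"
        by (simp add: k power_mult_distrib[symmetric])
      then show ?thesis
        unfolding Q(1) emeasure_dyadic_cell[OF assms(1)]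
        using assms(1) by (simp add: ennreal_mult flip: ennreal_power)
    qed
    \<comment> \<open>The parent is 2^N times as large, so passing to the child raises the density
      bound from 2^(-N-1) to at most 1/2.\<close>
    have "2 ^ CARD('n) * (2 * emeasure lebesgue (E \<inter> Q)) = ?C * emeasure lebesgue (E \<inter> Q)"
      by (simp add: mult.commute mult.left_commute)
    also have "\<dots> \<le> ?C * emeasure lebesgue (E \<inter> dyadic_cell r j x)"
      using dyadic_cell_antimono[of j k r x] assms(2) dyadic_cell_borel[of r j x]
      by (intro mult_left_mono emeasure_mono) (auto simp: Q(1) k)
    also have "\<dots> \<le> 2 ^ CARD('n) * emeasure lebesgue Q"
      using Q(3)[of j] k parent by (simp add: P_def not_less)
    finally have "2 * emeasure lebesgue (E \<inter> Q) \<le> emeasure lebesgue Q"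
      by (subst (asm) ennreal_mult_le_mult_iff) (auto simp: power_eq_top_ennreal)
    then have "emeasure lebesgue (F \<inter> Q) \<le> c * emeasure lebesgue Q"
      using local Q(1) by simp
    \<comment> \<open>Here \<open>P Q\<close> itself enters, charging the whole cell to the part of
      \<open>E\<close> inside it.\<close>
    also have "\<dots> \<le> c * (?C * emeasure lebesgue (E \<inter> Q))"
      using Q(2) by (intro mult_left_mono) (auto simp: P_def)
    finally show "emeasure lebesgue (F \<inter> Q) \<le> c * ?C * emeasure lebesgue (E \<inter> Q)"
      by (simp add: mult.assoc)
  qed
  also have "\<dots> = c * ?C * (\<integral>\<^sup>+Q. emeasure lebesgue (E \<inter> Q) \<partial>count_space \<Q>)"
    by (rule nn_integral_cmult) simp
  also have "(\<integral>\<^sup>+Q. emeasure lebesgue (E \<inter> Q) \<partial>count_space \<Q>) = emeasure lebesgue (E \<inter> \<Union>\<Q>)"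
    by (rule emeasure_disjoint_countable_Union[OF \<Q>(1,2) Q_sets assms(2), symmetric])
  also have "c * ?C * \<dots> \<le> c * ?C * emeasure lebesgue E"
    using assms(2) by (intro mult_left_mono emeasure_mono) auto
  finally show ?thesis .
qed

section \<open>Mean oscillation and level sets\<close>

text \<open>Serves the measurability of inner integrals that depend on a parameter. A cover by Borel
  sets of finite measure carries over from \<open>lborel\<close>.\<close>

lemma sigma_finite_lebesgue: "sigma_finite_measure (lebesgue :: 'a::euclidean_space measure)"
proof
  obtain A :: "'a set set" where A: "countable A" "A \<subseteq> sets lborel" "\<Union>A = space lborel"
      "\<forall>a\<in>A. emeasure lborel a \<noteq> \<infinity>"
    using lborel.sigma_finite_countable by blast
  then show "\<exists>A::'a set set. countable A \<and> A \<subseteq> sets lebesgue \<and> \<Union>A = space lebesgue \<and>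
      (\<forall>a\<in>A. emeasure lebesgue a \<noteq> \<infinity>)"
    by (intro exI[of _ A]) (auto simp: subset_iff)
qed

lemma translation_measurable_lebesgue:
  "(\<lambda>x. x + h) \<in> lebesgue \<rightarrow>\<^sub>M (lebesgue :: 'a::euclidean_space measure)"
  using lebesgue_affine_measurable[of "\<lambda>_. 1" h]
  by (simp add: euclidean_representation add.commute)

lemma nn_integral_lebesgue_translation:
  fixes h :: "'a::euclidean_space"
  assumes "g \<in> borel_measurable lebesgue"
  shows "(\<integral>\<^sup>+x. g (x + h) \<partial>lebesgue) = (\<integral>\<^sup>+x. g x \<partial>lebesgue)"
proof -
  \<comment> \<open>The affine change of variables with every scale factor 1, so that the Jacobian
    density is 1.\<close>
  have "lebesgue = density (distr lebesgue lebesgue (\<lambda>x. x + h)) (\<lambda>_. 1)"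
    using lebesgue_affine_euclidean[of "\<lambda>_. 1" h]
    by (simp add: euclidean_representation add.commute)
  then have "distr lebesgue lebesgue (\<lambda>x. x + h) = lebesgue"
    by (simp add: density_1)
  then show ?thesis
    using nn_integral_distr[OF translation_measurable_lebesgue[of h], of g] assms by simp
qed

text \<open>The numerator of \<open>mean_osc\<close>; working with it keeps divisions out of the
  estimates in \<open>ennreal\<close>.\<close>

definition total_osc :: "(real ^ 'n \<Rightarrow> real) \<Rightarrow> (real ^ 'n) set \<Rightarrow> ennreal" where
  "total_osc u C = (\<integral>\<^sup>+x\<in>C. (\<integral>\<^sup>+z\<in>C. ennreal \<bar>u z - u x\<bar> \<partial>lebesgue) \<partial>lebesgue)"

lemma total_osc_inner_measurable:
  fixes u :: "real ^ 'n \<Rightarrow> real"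
  assumes [measurable]: "u \<in> borel_measurable lebesgue" "C \<in> sets lebesgue"
  shows "(\<lambda>x. \<integral>\<^sup>+z\<in>C. ennreal \<bar>u z - u x\<bar> \<partial>lebesgue) \<in> borel_measurable lebesgue"
proof -
  interpret sigma_finite_measure "lebesgue :: (real ^ 'n) measure"
    by (rule sigma_finite_lebesgue)
  show ?thesis by measurable
qed

text \<open>Reduces the oscillation of the shifted function to that of \<open>u\<close> on a shifted
  cube of the same size, where the VMO bound is available.\<close>

lemma total_osc_translation:
  fixes u :: "real ^ 'n \<Rightarrow> real"
  assumes [measurable]: "u \<in> borel_measurable lebesgue"
  shows "total_osc (\<lambda>x. u (x + h)) (cbox a b) = total_osc u (cbox (a + h) (b + h))"
proof -
  have ind: "indicator (cbox (a + h) (b + h)) (x + h) = (indicator (cbox a b) x :: ennreal)" for x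
    by (simp add: indicator_def mem_box_cart)
  have C: "cbox (a + h) (b + h) \<in> sets lebesgue"
    by simp
  have "total_osc u (cbox (a + h) (b + h)) =
     (\<integral>\<^sup>+x. (\<integral>\<^sup>+z\<in>cbox (a + h) (b + h). ennreal \<bar>u z - u (x + h)\<bar> \<partial>lebesgue) *
        indicator (cbox (a + h) (b + h)) (x + h) \<partial>lebesgue)"
    unfolding total_osc_def
    by (intro nn_integral_lebesgue_translation[symmetric] borel_measurable_times_ennreal
        total_osc_inner_measurable[OF assms C] borel_measurable_indicator C)
  also have "\<dots> = (\<integral>\<^sup>+x. (\<integral>\<^sup>+z. ennreal \<bar>u (z + h) - u (x + h)\<bar> *
       indicator (cbox (a + h) (b + h)) (z + h) \<partial>lebesgue) *
        indicator (cbox (a + h) (b + h)) (x + h) \<partial>lebesgue)"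
  proof -
    have "(\<integral>\<^sup>+z\<in>cbox (a + h) (b + h). ennreal \<bar>u z - c\<bar> \<partial>lebesgue) =
      (\<integral>\<^sup>+z. ennreal \<bar>u (z + h) - c\<bar> * indicator (cbox (a + h) (b + h)) (z + h) \<partial>lebesgue)" for c
      by (intro nn_integral_lebesgue_translation[symmetric] borel_measurable_times_ennreal
          borel_measurable_indicator C) measurable
    then show ?thesis by simp
  qed
  finally show ?thesis
    by (simp add: ind total_osc_def)
qed

lemma total_osc_diff_le:
  fixes u v :: "real ^ 'n \<Rightarrow> real"
  assumes [measurable]: "u \<in> borel_measurable lebesgue" "v \<in> borel_measurable lebesgue"
    "C \<in> sets lebesgue"
  shows "total_osc (\<lambda>x. v x - u x) C \<le> total_osc v C + total_osc u C"
proof -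
  have "total_osc (\<lambda>x. v x - u x) C \<le>
    (\<integral>\<^sup>+x. ((\<integral>\<^sup>+z\<in>C. ennreal \<bar>v z - v x\<bar> \<partial>lebesgue) + (\<integral>\<^sup>+z\<in>C. ennreal \<bar>u z - u x\<bar> \<partial>lebesgue))
       * indicator C x \<partial>lebesgue)"
    unfolding total_osc_def
  proof (intro nn_integral_mono mult_right_mono)
    fix x
    have "(\<integral>\<^sup>+z\<in>C. ennreal \<bar>v z - u z - (v x - u x)\<bar> \<partial>lebesgue) \<le>
      (\<integral>\<^sup>+z. ennreal \<bar>v z - v x\<bar> * indicator C z + ennreal \<bar>u z - u x\<bar> * indicator C z \<partial>lebesgue)"
    proof (rule nn_integral_mono)
      fix z
      have "ennreal \<bar>v z - u z - (v x - u x)\<bar> \<le> ennreal (\<bar>v z - v x\<bar> + \<bar>u z - u x\<bar>)"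
        by (intro ennreal_leI) linarith
      then show "ennreal \<bar>v z - u z - (v x - u x)\<bar> * indicator C z
          \<le> ennreal \<bar>v z - v x\<bar> * indicator C z + ennreal \<bar>u z - u x\<bar> * indicator C z"
        by (simp add: indicator_def ennreal_plus)
    qed
    also have "\<dots> = (\<integral>\<^sup>+z\<in>C. ennreal \<bar>v z - v x\<bar> \<partial>lebesgue) + (\<integral>\<^sup>+z\<in>C. ennreal \<bar>u z - u x\<bar> \<partial>lebesgue)"
      by (rule nn_integral_add) measurable
    finally show "(\<integral>\<^sup>+z\<in>C. ennreal \<bar>v z - u z - (v x - u x)\<bar> \<partial>lebesgue) \<le> \<dots>" .
  qed simp
  also have "\<dots> = total_osc v C + total_osc u C"
    unfolding total_osc_def distrib_right
    using total_osc_inner_measurable[OF assms(1,3)] total_osc_inner_measurable[OF assms(2,3)]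
    by (intro nn_integral_add) (auto intro!: borel_measurable_times_ennreal borel_measurable_indicator assms(3))
  finally show ?thesis .
qed

text \<open>A Chebyshev inequality on pairs: if one point has value at most \<open>t\<close> and the
  other above \<open>t + d\<close> in modulus, the values differ by at least
  \<open>d\<close>.\<close>

lemma level_set_le_total_osc:
  fixes f :: "real ^ 'n \<Rightarrow> real"
  assumes [measurable]: "f \<in> borel_measurable lebesgue" "C \<in> sets lebesgue" and "0 \<le> d"
  shows "ennreal d * emeasure lebesgue ({x. \<bar>f x\<bar> \<le> t} \<inter> C) *
      emeasure lebesgue ({x. \<bar>f x\<bar> > t + d} \<inter> C) \<le> total_osc f C"
proof -
  let ?G = "{x. \<bar>f x\<bar> \<le> t} \<inter> C" and ?F = "{x. \<bar>f x\<bar> > t + d} \<inter> C"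
  have "{x \<in> space lebesgue. \<bar>f x\<bar> \<le> t} \<in> sets lebesgue"
    "{x \<in> space lebesgue. \<bar>f x\<bar> > t + d} \<in> sets lebesgue"
    by measurable
  then have meas: "?G \<in> sets lebesgue" "?F \<in> sets lebesgue"
    by auto
  have "ennreal d * emeasure lebesgue ?G * emeasure lebesgue ?F =
     (\<integral>\<^sup>+x. (ennreal d * emeasure lebesgue ?G) * indicator ?F x \<partial>lebesgue)"
    using meas by (simp add: nn_integral_cmult_indicator)
  also have "\<dots> \<le> total_osc f C"
    unfolding total_osc_def
  proof (rule nn_integral_mono)
    fix x
    show "(ennreal d * emeasure lebesgue ?G) * indicator ?F x
        \<le> (\<integral>\<^sup>+z\<in>C. ennreal \<bar>f z - f x\<bar> \<partial>lebesgue) * indicator C x"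
    proof (cases "x \<in> ?F")
      case True
      have "ennreal d * emeasure lebesgue ?G = (\<integral>\<^sup>+z. ennreal d * indicator ?G z \<partial>lebesgue)"
        using meas by (simp add: nn_integral_cmult_indicator)
      also have "\<dots> \<le> (\<integral>\<^sup>+z\<in>C. ennreal \<bar>f z - f x\<bar> \<partial>lebesgue)"
        using True by (intro nn_integral_mono) (auto simp: indicator_def intro!: ennreal_leI)
      finally show ?thesis
        using True by simp
    qed simp
  qed
  finally show ?thesis .
qed

text \<open>Multiplying the quotient back is legitimate because the volume is neither 0 nor
  \<open>top\<close>.\<close>

lemma total_osc_le_of_mean_osc:
  fixes u :: "real ^ 'n \<Rightarrow> real"
  assumes "mean_osc u C \<le> e" "emeasure lebesgue C = ennreal V" "0 < V"
  shows "total_osc u C \<le> e * (emeasure lebesgue C)\<^sup>2"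
proof -
  let ?V = "(emeasure lebesgue C)\<^sup>2"
  have V: "?V \<noteq> 0" "?V < top"
    using assms(2,3) by (auto simp: power_eq_top_ennreal less_top[symmetric])
  have "total_osc u C = mean_osc u C * ?V"
    unfolding mean_osc_def total_osc_def[symmetric] ennreal_divide_times ennreal_divide_self[OF V]
    by simp
  also have "\<dots> \<le> e * ?V"
    using assms(1) by (intro mult_right_mono) auto
  finally show ?thesis .
qed

section \<open>Decay of the level sets of the increment\<close>

lemma increment_measurable:
  fixes u :: "real ^ 'n \<Rightarrow> real"
  assumes "u \<in> borel_measurable lebesgue"
  shows "(\<lambda>x. u (x + h)) \<in> borel_measurable lebesgue"
    and "(\<lambda>x. u (x + h) - u x) \<in> borel_measurable lebesgue"
proof -
  show *: "(\<lambda>x. u (x + h)) \<in> borel_measurable lebesgue"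
    using measurable_compose[OF translation_measurable_lebesgue assms] .
  show "(\<lambda>x. u (x + h) - u x) \<in> borel_measurable lebesgue"
    using * assms by (rule borel_measurable_diff)
qed

lemma level_set_in_sets_lebesgue:
  fixes f :: "real ^ 'n \<Rightarrow> real"
  assumes [measurable]: "f \<in> borel_measurable lebesgue"
  shows "{x. \<bar>f x\<bar> > t} \<in> sets lebesgue" "{x. \<bar>f x\<bar> \<le> t} \<in> sets lebesgue"
proof -
  have "{x \<in> space lebesgue. \<bar>f x\<bar> > t} \<in> sets lebesgue"
    "{x \<in> space lebesgue. \<bar>f x\<bar> \<le> t} \<in> sets lebesgue"
    by measurable
  then show "{x. \<bar>f x\<bar> > t} \<in> sets lebesgue" "{x. \<bar>f x\<bar> \<le> t} \<in> sets lebesgue"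
    by auto
qed

text \<open>The set where the increment is at most \<open>t\<close> in modulus fills at least half
  of the cube. The triangle inequality bounds the total oscillation of the increment by 2 e |C|^2,
  so the inequality on pairs gives the factor 4.\<close>

lemma cube_level_set_decay:
  fixes u :: "real ^ 'n \<Rightarrow> real" and h a b :: "real ^ 'n"
  defines "f \<equiv> \<lambda>x. u (x + h) - u x"
  assumes u: "u \<in> borel_measurable lebesgue" and "0 < l" "\<And>i. b $ i - a $ i = l" "0 \<le> d"
    and osc: "mean_osc u (cbox a b) \<le> e" "mean_osc u (cbox (a + h) (b + h)) \<le> e"
    and half: "2 * emeasure lebesgue ({x. \<bar>f x\<bar> > t} \<inter> cbox a b) \<le> emeasure lebesgue (cbox a b)"
  shows "ennreal d * emeasure lebesgue ({x. \<bar>f x\<bar> > t + d} \<inter> cbox a b)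
    \<le> 4 * e * emeasure lebesgue (cbox a b)"
proof -
  let ?C = "cbox a b"
  let ?G = "{x. \<bar>f x\<bar> \<le> t} \<inter> ?C" and ?E = "{x. \<bar>f x\<bar> > t} \<inter> ?C"
    and ?F = "{x. \<bar>f x\<bar> > t + d} \<inter> ?C"
  define V where "V = l ^ CARD('n)"
  have "0 < V"
    using \<open>0 < l\<close> by (simp add: V_def)
  have V: "emeasure lebesgue ?C = ennreal V" "emeasure lebesgue (cbox (a + h) (b + h)) = ennreal V"
    using emeasure_cube(1)[of l b a] emeasure_cube(1)[of l "b + h" "a + h"] assms(3,4)
    by (auto simp: V_def)
  have f: "f \<in> borel_measurable lebesgue"
    unfolding f_def by (rule increment_measurable[OF u])
  have "?E \<in> sets lebesgue" "?G \<in> sets lebesgue"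
    using level_set_in_sets_lebesgue[OF f, of t] by auto
  then have "emeasure lebesgue ?G + emeasure lebesgue ?E = emeasure lebesgue (?G \<union> ?E)"
    by (intro plus_emeasure) auto
  also have "?G \<union> ?E = ?C" by auto
  finally have sum: "emeasure lebesgue ?C = emeasure lebesgue ?G + emeasure lebesgue ?E" ..
  \<comment> \<open>Doubling the partition avoids subtraction: a copy of the finite quantity |C| is
    cancelled from both sides.\<close>
  have "emeasure lebesgue ?C + emeasure lebesgue ?C
      = 2 * emeasure lebesgue ?G + 2 * emeasure lebesgue ?E"
    by (metis sum mult_2 distrib_left)
  also have "\<dots> \<le> emeasure lebesgue ?C + 2 * emeasure lebesgue ?G"
    using half by (subst add.commute) (intro add_right_mono)
  finally have G: "emeasure lebesgue ?C \<le> 2 * emeasure lebesgue ?G"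
    by (simp add: V ennreal_add_left_cancel_le)
  have "emeasure lebesgue ?C * (ennreal d * emeasure lebesgue ?F)
      \<le> (2 * emeasure lebesgue ?G) * (ennreal d * emeasure lebesgue ?F)"
    using G by (rule mult_right_mono) simp
  also have "\<dots> = 2 * (ennreal d * emeasure lebesgue ?G * emeasure lebesgue ?F)"
    by (simp add: ac_simps)
  also have "\<dots> \<le> 2 * total_osc f ?C"
    using level_set_le_total_osc[OF f, of ?C d t] \<open>0 \<le> d\<close> by (intro mult_left_mono) auto
  also have "\<dots> \<le> 2 * (total_osc (\<lambda>x. u (x + h)) ?C + total_osc u ?C)"
    unfolding f_def using total_osc_diff_le[OF u increment_measurable(1)[OF u], of ?C]
    by (intro mult_left_mono) auto
  also have "\<dots> \<le> 2 * (e * (emeasure lebesgue ?C)\<^sup>2 + e * (emeasure lebesgue ?C)\<^sup>2)"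
    using total_osc_le_of_mean_osc[OF osc(1) V(1) \<open>0 < V\<close>]
      total_osc_le_of_mean_osc[OF osc(2) V(2) \<open>0 < V\<close>]
    by (intro mult_left_mono add_mono) (simp_all add: total_osc_translation[OF u] V)
  also have "\<dots> = emeasure lebesgue ?C * (4 * e * emeasure lebesgue ?C)"
    by (simp add: power2_eq_square ac_simps flip: mult_2)
  finally show ?thesis
    using V(1) \<open>0 < V\<close> by (subst (asm) ennreal_mult_le_mult_iff) auto
qed

text \<open>The two sets differ only within the boundary of the box, which is null.\<close>

lemma emeasure_Int_dyadic_cell:
  fixes a b x :: "real ^ 'n"
  assumes "box a b \<subseteq> dyadic_cell r k x" "dyadic_cell r k x \<subseteq> cbox a b" "S \<in> sets lebesgue"
  shows "emeasure lebesgue (S \<inter> dyadic_cell r k x) = emeasure lebesgue (S \<inter> cbox a b)"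
proof (rule emeasure_eq_AE)
  have "cbox a b - box a b \<in> null_sets lebesgue"
    using negligible_frontier_interval negligible_iff_null_sets by blast
  then have "AE y in lebesgue. y \<notin> cbox a b - box a b"
    by (rule AE_not_in)
  then show "AE y in lebesgue. y \<in> S \<inter> dyadic_cell r k x \<longleftrightarrow> y \<in> S \<inter> cbox a b"
    by eventually_elim (use assms(1,2) in auto)
  show "S \<inter> dyadic_cell r k x \<in> sets lebesgue" "S \<inter> cbox a b \<in> sets lebesgue"
    using assms(3) dyadic_cell_borel[of r k x] by auto
qed

lemma diameter_cube_le:
  fixes a b :: "real ^ 'n"
  assumes "\<And>i. b $ i - a $ i = l" "0 \<le> l"
  shows "diameter (cbox a b) \<le> real CARD('n) * l"
proof (rule diameter_le)
  fix x y assume xy: "x \<in> cbox a b" "y \<in> cbox a b"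
  have "\<bar>(x - y) $ i\<bar> \<le> l" for i
    using xy assms(1)[of i] unfolding mem_box_cart by (smt (verit) vector_minus_component)
  then have "(\<Sum>i\<in>UNIV. \<bar>(x - y) $ i\<bar>) \<le> (\<Sum>i\<in>(UNIV::'n set). l)"
    by (intro sum_mono) auto
  then show "norm (x - y) \<le> real CARD('n) * l"
    using norm_le_l1_cart[of "x - y"] by simp
qed (use assms in auto)

text \<open>The constants fit as follows. Oscillation d/2^(N+4) gives, after the factor 4 and
  division by d, a local ratio of 2^(-N-2); the stopping argument costs 2^(N+1) and leaves 1/2. The
  hypothesis \<open>small\<close> guarantees low density in every cell of side
  \<open>r\<close>.\<close>

lemma level_set_decay:
  fixes u :: "real ^ 'n \<Rightarrow> real" and h :: "real ^ 'n"
  defines "f \<equiv> \<lambda>x. u (x + h) - u x"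
  assumes u: "u \<in> borel_measurable lebesgue" and "0 < r" "0 < d"
    and osc: "\<And>C. is_cube C \<Longrightarrow> diameter C \<le> real CARD('n) * r \<Longrightarrow>
        mean_osc u C \<le> ennreal (d / 2 ^ (CARD('n) + 4))"
    and small: "2 ^ (CARD('n) + 1) * emeasure lebesgue {x. \<bar>f x\<bar> > t} \<le> ennreal (r ^ CARD('n))"
  shows "2 * emeasure lebesgue {x. \<bar>f x\<bar> > t + d} \<le> emeasure lebesgue {x. \<bar>f x\<bar> > t}"
proof -
  let ?E = "{x. \<bar>f x\<bar> > t}" and ?F = "{x. \<bar>f x\<bar> > t + d}"
  let ?c = "ennreal (1 / 2 ^ (CARD('n) + 2))"
  have f: "f \<in> borel_measurable lebesgue"
    unfolding f_def by (rule increment_measurable[OF u])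
  note sets = level_set_in_sets_lebesgue(1)[OF f]
  have "emeasure lebesgue ?F \<le> ?c * 2 ^ (CARD('n) + 1) * emeasure lebesgue ?E"
  proof (rule emeasure_le_by_stopping_cells[OF \<open>0 < r\<close> sets sets])
    show "?F \<subseteq> ?E" using \<open>0 < d\<close> by auto
    show "emeasure lebesgue ?E < top"
    proof (rule ccontr)
      assume "\<not> ?thesis"
      then have "emeasure lebesgue ?E = top" by (simp add: less_top[symmetric])
      then show False using small by (simp add: ennreal_mult_top top_unique)
    qed
    fix x :: "real ^ 'n"
    have "emeasure lebesgue (?E \<inter> dyadic_cell r 0 x) \<le> emeasure lebesgue ?E"
      using sets by (intro emeasure_mono) auto
    then have "2 ^ (CARD('n) + 1) * emeasure lebesgue (?E \<inter> dyadic_cell r 0 x)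
        \<le> 2 ^ (CARD('n) + 1) * emeasure lebesgue ?E"
      by (intro mult_left_mono) auto
    also note small
    finally show "2 ^ (CARD('n) + 1) * emeasure lebesgue (?E \<inter> dyadic_cell r 0 x)
        \<le> emeasure lebesgue (dyadic_cell r 0 x)"
      unfolding emeasure_dyadic_cell[OF \<open>0 < r\<close>] by simp
  next
    fix k and x :: "real ^ 'n"
    let ?D = "dyadic_cell r k x"
    assume half: "2 * emeasure lebesgue (?E \<inter> ?D) \<le> emeasure lebesgue ?D"
    define l where "l = r / 2 ^ k"
    have l: "0 < l" "l \<le> r"
      using \<open>0 < r\<close> by (auto simp: l_def divide_le_eq mult_le_cancel_left1)
    obtain a b where ab: "\<And>i. b $ i - a $ i = l" "box a b \<subseteq> ?D" "?D \<subseteq> cbox a b"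
      using dyadic_cell_between_boxes[OF \<open>0 < r\<close>, of k x] unfolding l_def by metis
    have Int: "emeasure lebesgue (S \<inter> ?D) = emeasure lebesgue (S \<inter> cbox a b)"
      if "S \<in> sets lebesgue" for S
      using emeasure_Int_dyadic_cell[OF ab(2,3) that] .
    have D: "emeasure lebesgue ?D = emeasure lebesgue (cbox a b)"
      using Int[of UNIV] by simp
    have osc': "mean_osc u (cbox a' b') \<le> ennreal (d / 2 ^ (CARD('n) + 4))"
      if "\<And>i. b' $ i - a' $ i = l" for a' b'
    proof (rule osc)
      show "is_cube (cbox a' b')"
        using that l(1) by (auto simp: is_cube_def)
      have "real CARD('n) * l \<le> real CARD('n) * r"
        using l(2) by simp
      then show "diameter (cbox a' b') \<le> real CARD('n) * r"
        using diameter_cube_le[OF that less_imp_le[OF l(1)]] by linarith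
    qed
    have "ennreal d * emeasure lebesgue (?F \<inter> cbox a b)
        \<le> 4 * ennreal (d / 2 ^ (CARD('n) + 4)) * emeasure lebesgue (cbox a b)"
      unfolding f_def
    proof (rule cube_level_set_decay[OF u l(1) ab(1)])
      show "2 * emeasure lebesgue ({x. \<bar>u (x + h) - u x\<bar> > t} \<inter> cbox a b) \<le> emeasure lebesgue (cbox a b)"
        using half unfolding D Int[OF sets] unfolding f_def .
    qed (use \<open>0 < d\<close> ab(1) in \<open>auto intro!: osc'\<close>)
    also have "4 * ennreal (d / 2 ^ (CARD('n) + 4)) = ennreal d * ?c"
      using \<open>0 < d\<close> by (simp add: ennreal_mult[symmetric] power_add flip: ennreal_numeral)
    finally have "ennreal d * emeasure lebesgue (?F \<inter> cbox a b)
        \<le> ennreal d * (?c * emeasure lebesgue (cbox a b))"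
      by (simp add: mult.assoc)
    then show "emeasure lebesgue (?F \<inter> ?D) \<le> ?c * emeasure lebesgue ?D"
      unfolding D Int[OF sets] using \<open>0 < d\<close> by (subst (asm) ennreal_mult_le_mult_iff) auto
  qed
  then have "2 * emeasure lebesgue ?F \<le> 2 * (?c * 2 ^ (CARD('n) + 1) * emeasure lebesgue ?E)"
    by (rule mult_left_mono) simp
  also have "\<dots> = (?c * 2 ^ (CARD('n) + 2)) * emeasure lebesgue ?E"
    by (simp add: ac_simps)
  also have "?c * 2 ^ (CARD('n) + 2) = 1"
  proof -
    have "2 ^ (CARD('n) + 2) = ennreal (2 ^ (CARD('n) + 2))"
      by (metis ennreal_numeral ennreal_power zero_le_numeral)
    then show ?thesis
      by (simp flip: ennreal_mult'')
  qed
  finally show ?thesis by simp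
qed

text \<open>The halving step is iterated from height \<open>d\<close> in increments of
  \<open>d\<close>; the smallness hypothesis persists because higher level sets are smaller.\<close>

lemma level_set_geometric_decay:
  fixes u :: "real ^ 'n \<Rightarrow> real" and h :: "real ^ 'n"
  defines "f \<equiv> \<lambda>x. u (x + h) - u x"
  assumes u: "u \<in> borel_measurable lebesgue" and "0 < r" "0 < d"
    and osc: "\<And>C. is_cube C \<Longrightarrow> diameter C \<le> real CARD('n) * r \<Longrightarrow>
        mean_osc u C \<le> ennreal (d / 2 ^ (CARD('n) + 4))"
    and small: "2 ^ (CARD('n) + 1) * emeasure lebesgue {x. \<bar>f x\<bar> > d} \<le> ennreal (r ^ CARD('n))"
  shows "2 ^ k * emeasure lebesgue {x. \<bar>f x\<bar> > real (Suc k) * d} \<le> emeasure lebesgue {x. \<bar>f x\<bar> > d}"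
proof (induction k)
  case (Suc k)
  let ?E = "\<lambda>k. {x. \<bar>f x\<bar> > real (Suc k) * d}"
  have f: "f \<in> borel_measurable lebesgue"
    unfolding f_def by (rule increment_measurable[OF u])
  have "d \<le> real (Suc k) * d"
    using \<open>0 < d\<close> by (simp add: mult_le_cancel_right1)
  then have "emeasure lebesgue (?E k) \<le> emeasure lebesgue {x. \<bar>f x\<bar> > d}"
    using level_set_in_sets_lebesgue(1)[OF f] by (intro emeasure_mono) auto
  then have "2 ^ (CARD('n) + 1) * emeasure lebesgue (?E k) \<le> ennreal (r ^ CARD('n))"
    using small by (meson mult_left_mono order.trans zero_le)
  then have "2 * emeasure lebesgue {x. \<bar>f x\<bar> > real (Suc k) * d + d} \<le> emeasure lebesgue (?E k)"
    unfolding f_def by (intro level_set_decay[OF u \<open>0 < r\<close> \<open>0 < d\<close> osc]) auto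
  moreover have "real (Suc k) * d + d = real (Suc (Suc k)) * d"
    by (simp add: algebra_simps)
  ultimately have "2 * emeasure lebesgue (?E (Suc k)) \<le> emeasure lebesgue (?E k)"
    by simp
  then have "2 ^ k * (2 * emeasure lebesgue (?E (Suc k))) \<le> 2 ^ k * emeasure lebesgue (?E k)"
    by (rule mult_left_mono) simp
  then show ?case
    using Suc by (simp add: ac_simps)
qed simp

section \<open>Summation over the level sets\<close>

lemma weak_Lp_seminorm_level_set:
  fixes f :: "real ^ 'n \<Rightarrow> real"
  assumes "weak_Lp_seminorm p f \<le> ennreal b" "0 \<le> b" "0 < p" "0 < t"
  shows "emeasure lebesgue {x. \<bar>f x\<bar> > t} \<le> ennreal (b powr p / t powr p)"
proof -
  define S where "S = (SUP t\<in>{0<..}. ennreal t * emeasure lebesgue {x. \<bar>f x\<bar> powr p > t})"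
  \<comment> \<open>The finite bound excludes the \<open>top\<close> branch of the seminorm, so
    \<open>enn2real\<close> loses nothing.\<close>
  have "S \<noteq> top"
    using assms(1) by (auto simp: weak_Lp_seminorm_def S_def[symmetric] top_unique)
  then have "ennreal (enn2real S powr (1 / p)) \<le> ennreal b"
    using assms(1) by (simp add: weak_Lp_seminorm_def S_def[symmetric])
  then have "enn2real S powr (1 / p) \<le> b"
    using assms(2) by simp
  then have "(enn2real S powr (1 / p)) powr p \<le> b powr p"
    using assms(3) by (intro powr_mono2) auto
  then have S: "enn2real S \<le> b powr p"
    using assms(3) by (simp add: powr_powr)
  have set_eq: "{x. \<bar>f x\<bar> powr p > t powr p} = {x. \<bar>f x\<bar> > t}"
    using assms(3,4) powr_less_mono2[of p t] powr_mono2[of p _ t] by (auto simp flip: not_le)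
  have "ennreal (t powr p) * emeasure lebesgue {x. \<bar>f x\<bar> > t} \<le> S"
    unfolding S_def set_eq[symmetric] using assms(4) by (intro SUP_upper) auto
  also have "\<dots> \<le> ennreal (b powr p)"
    using S \<open>S \<noteq> top\<close> by (metis ennreal_enn2real ennreal_leI less_top)
  also have "\<dots> = ennreal (t powr p) * ennreal (b powr p / t powr p)"
    using assms(4) by (simp flip: ennreal_mult'')
  finally show ?thesis
    using assms(4) by (subst (asm) ennreal_mult_le_mult_iff) auto
qed

lemma weak_Besov_level_set:
  fixes u :: "real ^ 'n \<Rightarrow> real"
  assumes "u \<in> weak_Besov s p" "0 < p"
  obtains A where "0 < A" "\<And>h t. h \<noteq> 0 \<Longrightarrow> 0 < t \<Longrightarrow>
    emeasure lebesgue {x. \<bar>u (x + h) - u x\<bar> > t} \<le> ennreal (A * norm h powr (s * p) / t powr p)"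
proof -
  let ?W = "\<lambda>h. weak_Lp_seminorm p (\<lambda>x. u (x + h) - u x)"
  let ?B = "SUP t\<in>{0<..}. ennreal (t powr (- s)) * (SUP h\<in>{h. norm h \<le> t}. ?W h)"
  have "?B < top"
    using assms(1) by (simp add: weak_Besov_def)
  then obtain b' where b': "?B = ennreal b'" "0 \<le> b'"
    by (cases ?B) auto
  \<comment> \<open>Adding 1 makes the constant strictly positive even if the supremum is 0.\<close>
  define b where "b = b' + 1"
  show thesis
  proof (rule that[of "b powr p"])
    show "0 < b powr p" using b'(2) by (simp add: b_def)
    fix h :: "real ^ 'n" and t :: real assume h: "h \<noteq> 0" and t: "0 < t"
    \<comment> \<open>The outer supremum is tested at the radius \<open>norm h\<close>, the inner
      one at \<open>h\<close> itself.\<close>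
    have "ennreal (norm h powr (- s)) * ?W h \<le>
        ennreal (norm h powr (- s)) * (SUP h'\<in>{h'. norm h' \<le> norm h}. ?W h')"
      by (intro mult_left_mono SUP_upper) auto
    also have "\<dots> \<le> ?B"
      using h by (intro SUP_upper) auto
    also have "\<dots> \<le> ennreal b"
      using b' by (simp add: b_def)
    also have "\<dots> = ennreal (norm h powr (- s)) * ennreal (b * norm h powr s)"
    proof -
      have "b = norm h powr (- s) * (b * norm h powr s)"
        using h by (simp add: powr_minus field_simps)
      then show ?thesis
        by (metis ennreal_mult' powr_ge_zero)
    qed
    finally have W: "?W h \<le> ennreal (b * norm h powr s)"
      using h by (subst (asm) ennreal_mult_le_mult_iff) auto
    have "(b * norm h powr s) powr p = b powr p * norm h powr (s * p)"
      using b'(2) by (simp add: b_def powr_mult powr_powr)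
    then show "emeasure lebesgue {x. \<bar>u (x + h) - u x\<bar> > t}
        \<le> ennreal (b powr p * norm h powr (s * p) / t powr p)"
      using weak_Lp_seminorm_level_set[OF W _ assms(2) t] b'(2) by (simp add: b_def)
  qed
qed

section \<open>Layer decomposition of the integral\<close>

text \<open>Heights up to \<open>2 * d\<close> are cut dyadically towards 0, where the weak bound
  will sum; larger heights are cut in steps of \<open>d\<close>, matching the geometric decay. At
  each point a single layer already dominates the integrand.\<close>

lemma nn_integral_powr_le_level_sets:
  fixes f :: "real ^ 'n \<Rightarrow> real"
  assumes f: "f \<in> borel_measurable lebesgue" and "0 < d" "0 < q"
  shows "(\<integral>\<^sup>+x. ennreal (\<bar>f x\<bar> powr q) \<partial>lebesgue) \<le>
     (\<Sum>j. ennreal ((2 * d * (1 / 2) ^ j) powr q) * emeasure lebesgue {x. \<bar>f x\<bar> > d * (1 / 2) ^ j}) +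
     (\<Sum>k. ennreal ((real (k + 3) * d) powr q) * emeasure lebesgue {x. \<bar>f x\<bar> > real (k + 2) * d})"
proof -
  define g1 :: "nat \<Rightarrow> real ^ 'n \<Rightarrow> ennreal" where
    "g1 j x = ennreal ((2 * d * (1 / 2) ^ j) powr q) * indicator {x. \<bar>f x\<bar> > d * (1 / 2) ^ j} x" for j x
  define g2 :: "nat \<Rightarrow> real ^ 'n \<Rightarrow> ennreal" where
    "g2 k x = ennreal ((real (k + 3) * d) powr q) * indicator {x. \<bar>f x\<bar> > real (k + 2) * d} x" for k x
  note sets = level_set_in_sets_lebesgue(1)[OF f]
  have [measurable]: "g1 j \<in> borel_measurable lebesgue" "g2 j \<in> borel_measurable lebesgue" for j
    unfolding g1_def g2_def
    by (intro borel_measurable_times_ennreal borel_measurable_indicator sets borel_measurable_const)+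
  have term_le: "g j x \<le> (\<Sum>j. g j x)" for g :: "nat \<Rightarrow> real ^ 'n \<Rightarrow> ennreal" and j x
    using sum_le_suminf[of "\<lambda>j. g j x" "{j}"] by simp
  have pw: "ennreal (\<bar>f x\<bar> powr q) \<le> (\<Sum>j. g1 j x) + (\<Sum>k. g2 k x)" for x
  proof -
    consider "f x = 0" | "0 < \<bar>f x\<bar>" "\<bar>f x\<bar> \<le> 2 * d" | "2 * d < \<bar>f x\<bar>"
      by fastforce
    then show ?thesis
    proof cases
      case 2
      \<comment> \<open>Minimality gives the upper bound by twice the threshold; for
        \<open>j = 0\<close> that bound is the case assumption.\<close>
      define j where "j = (LEAST j. d * (1 / 2) ^ j < \<bar>f x\<bar>)"
      obtain n where "(1 / 2) ^ n < \<bar>f x\<bar> / d"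
        using real_arch_pow_inv[of "\<bar>f x\<bar> / d" "1 / 2"] 2 \<open>0 < d\<close> by auto
      then have "d * (1 / 2) ^ n < \<bar>f x\<bar>"
        using \<open>0 < d\<close> by (simp add: field_simps)
      then have j: "d * (1 / 2) ^ j < \<bar>f x\<bar>"
        unfolding j_def by (rule LeastI)
      have "\<bar>f x\<bar> \<le> 2 * d * (1 / 2) ^ j"
      proof (cases j)
        case 0
        then show ?thesis using 2 by simp
      next
        case (Suc i)
        then have "\<not> d * (1 / 2) ^ i < \<bar>f x\<bar>"
          using not_less_Least[of i "\<lambda>j. d * (1 / 2) ^ j < \<bar>f x\<bar>"] by (simp add: j_def)
        then show ?thesis using Suc by simp
      qed
      then have "ennreal (\<bar>f x\<bar> powr q) \<le> g1 j x"
        using j \<open>0 < q\<close> by (auto simp: g1_def intro!: ennreal_leI powr_mono2)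
      also have "\<dots> \<le> (\<Sum>j. g1 j x)" by (rule term_le)
      also have "\<dots> \<le> (\<Sum>j. g1 j x) + (\<Sum>k. g2 k x)" by simp
      finally show ?thesis .
    next
      case 3
      \<comment> \<open>The shift by 3 places the quotient in the interval from
        \<open>k + 2\<close>, excluded, to \<open>k + 3\<close>, included. As the quotient exceeds
        2, its ceiling is at least 3 and \<open>nat\<close> truncates nothing.\<close>
      define k where "k = nat (\<lceil>\<bar>f x\<bar> / d\<rceil> - 3)"
      have "2 < \<bar>f x\<bar> / d"
        using 3 \<open>0 < d\<close> by (simp add: field_simps)
      then have "real k = of_int \<lceil>\<bar>f x\<bar> / d\<rceil> - 3"
        by (simp add: k_def)
      then have "real (k + 2) < \<bar>f x\<bar> / d" "\<bar>f x\<bar> / d \<le> real (k + 3)"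
        by simp_all linarith+
      then have k: "real (k + 2) * d < \<bar>f x\<bar>" "\<bar>f x\<bar> \<le> real (k + 3) * d"
        using \<open>0 < d\<close> by (simp_all only: pos_less_divide_eq pos_divide_le_eq)
      then have "ennreal (\<bar>f x\<bar> powr q) \<le> g2 k x"
        using \<open>0 < q\<close> by (auto simp: g2_def intro!: ennreal_leI powr_mono2)
      also have "\<dots> \<le> (\<Sum>k. g2 k x)" by (rule term_le)
      also have "\<dots> \<le> (\<Sum>j. g1 j x) + (\<Sum>k. g2 k x)" by simp
      finally show ?thesis .
    qed simp
  qed
  have "(\<integral>\<^sup>+x. ennreal (\<bar>f x\<bar> powr q) \<partial>lebesgue) \<le> (\<integral>\<^sup>+x. (\<Sum>j. g1 j x) + (\<Sum>k. g2 k x) \<partial>lebesgue)"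
    by (intro nn_integral_mono pw)
  also have "\<dots> = (\<integral>\<^sup>+x. (\<Sum>j. g1 j x) \<partial>lebesgue) + (\<integral>\<^sup>+x. (\<Sum>k. g2 k x) \<partial>lebesgue)"
    by (rule nn_integral_add) measurable
  also have "\<dots> = (\<Sum>j. \<integral>\<^sup>+x. g1 j x \<partial>lebesgue) + (\<Sum>k. \<integral>\<^sup>+x. g2 k x \<partial>lebesgue)"
    by (simp add: nn_integral_suminf)
  also have "(\<lambda>j. \<integral>\<^sup>+x. g1 j x \<partial>lebesgue) =
      (\<lambda>j. ennreal ((2 * d * (1 / 2) ^ j) powr q) * emeasure lebesgue {x. \<bar>f x\<bar> > d * (1 / 2) ^ j})"
    unfolding g1_def by (intro ext nn_integral_cmult_indicator sets)
  also have "(\<lambda>k. \<integral>\<^sup>+x. g2 k x \<partial>lebesgue) =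
      (\<lambda>k. ennreal ((real (k + 3) * d) powr q) * emeasure lebesgue {x. \<bar>f x\<bar> > real (k + 2) * d})"
    unfolding g2_def by (intro ext nn_integral_cmult_indicator sets)
  finally show ?thesis .
qed

lemma summable_powr_half_power:
  assumes "0 < q"
  shows "summable (\<lambda>k. real (k + 3) powr q * (1 / 2) ^ (k + 1))"
proof (rule summable_comparison_test_bigo)
  show "summable (\<lambda>k. norm ((3 / 4) ^ k :: real))"
    \<comment> \<open>Any ratio strictly between 1/2 and 1 absorbs the polynomial factor; 3/4 is
      one.\<close>
    by (simp add: summable_geometric)
  show "(\<lambda>k. real (k + 3) powr q * (1 / 2) ^ (k + 1)) \<in> O(\<lambda>k. (3 / 4) ^ k)"
    using assms by real_asymp
qed

text \<open>What remains of the two layer sums once \<open>M * d powr (q - p)\<close> is factored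
  out. The first is a geometric series with ratio below 1 when \<open>p < q\<close>.\<close>

definition level_const :: "real \<Rightarrow> real \<Rightarrow> real" where
  "level_const p q = (\<Sum>j. 2 powr q * (2 powr (p - q)) ^ j) + (\<Sum>k. real (k + 3) powr q * (1 / 2) ^ (k + 1))"

lemma nn_integral_powr_le_of_decay:
  fixes f :: "real ^ 'n \<Rightarrow> real"
  assumes f: "f \<in> borel_measurable lebesgue" and "0 < d" "0 < p" "p < q" "0 \<le> M"
    and weak: "\<And>t. 0 < t \<Longrightarrow> emeasure lebesgue {x. \<bar>f x\<bar> > t} \<le> ennreal (M / t powr p)"
    and decay: "\<And>k. 2 ^ k * emeasure lebesgue {x. \<bar>f x\<bar> > real (Suc k) * d} \<le> emeasure lebesgue {x. \<bar>f x\<bar> > d}"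
  shows "(\<integral>\<^sup>+x. ennreal (\<bar>f x\<bar> powr q) \<partial>lebesgue) \<le> ennreal (M * d powr (q - p) * level_const p q)"
proof -
  define D where "D = M * d powr (q - p)"
  have "0 \<le> D" using \<open>0 \<le> M\<close> by (simp add: D_def)
  define a where "a j = 2 powr q * (2 powr (p - q)) ^ j" for j :: nat
  define b where "b k = real (k + 3) powr q * (1 / 2) ^ (k + 1)" for k
  have "2 powr (p - q) < 2 powr (0::real)"
    using \<open>p < q\<close> by (intro powr_less_mono) auto
  then have a: "summable a"
    unfolding a_def by (intro summable_mult summable_geometric) auto
  have b: "summable b"
    unfolding b_def using assms by (intro summable_powr_half_power) auto
  have ab: "0 \<le> a j" "0 \<le> b j" for j
    by (simp_all add: a_def b_def)
  have sum_ennreal: "(\<Sum>j. ennreal (D * c j)) = ennreal (D * suminf c)"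
    if "summable c" "\<And>j. 0 \<le> c j" for c
    using that \<open>0 \<le> D\<close> suminf_mult[OF that(1), of D] summable_mult[OF that(1), of D]
    by (simp add: suminf_ennreal2)
  \<comment> \<open>With T = d/2^j, the weak bound gives (2T)^q M/T^p = 2^q M T^(q-p), a geometric
    term in j.\<close>
  have 1: "ennreal ((2 * d * (1 / 2) ^ j) powr q) * emeasure lebesgue {x. \<bar>f x\<bar> > d * (1 / 2) ^ j}
      \<le> ennreal (D * a j)" for j
  proof -
    have "ennreal ((2 * d * (1 / 2) ^ j) powr q) * emeasure lebesgue {x. \<bar>f x\<bar> > d * (1 / 2) ^ j}
      \<le> ennreal ((2 * d * (1 / 2) ^ j) powr q) * ennreal (M / (d * (1 / 2) ^ j) powr p)"
      using \<open>0 < d\<close> by (intro mult_left_mono weak) auto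
    also have "\<dots> = ennreal ((2 * (d * (1 / 2) ^ j)) powr q * (M / (d * (1 / 2) ^ j) powr p))"
      unfolding mult.assoc by (intro ennreal_mult'[symmetric]) simp
    also have "(2 * (d * (1 / 2) ^ j)) powr q * (M / (d * (1 / 2) ^ j) powr p)
        = 2 powr q * M * (d * (1 / 2) ^ j) powr (q - p)"
      using \<open>0 < d\<close> by (subst powr_mult) (auto simp: powr_diff)
    also have "(d * (1 / 2) ^ j) powr (q - p) = d powr (q - p) * ((1 / 2) ^ j) powr (q - p)"
      using \<open>0 < d\<close> by (simp add: powr_mult)
    also have "((1 / 2) ^ j) powr (q - p) = (2 powr (p - q)) ^ j"
    proof -
      have "(1 / 2 :: real) powr (q - p) = 2 powr (p - q)"
        using powr_minus_divide[of 2 "q - p"] by (simp add: powr_divide)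
      moreover have "((1 / 2) ^ j) powr (q - p) = ((1 / 2 :: real) powr (q - p)) ^ j"
        using powr_realpow[of "1 / 2" j] powr_realpow[of "(1 / 2) powr (q - p)" j]
        by (metis half_gt_zero_iff mult.commute powr_gt_zero powr_powr zero_less_one less_numeral_extra(3))
      ultimately show ?thesis
        by simp
    qed
    finally show ?thesis
      by (simp add: D_def a_def ac_simps)
  qed
  have 2: "ennreal ((real (k + 3) * d) powr q) * emeasure lebesgue {x. \<bar>f x\<bar> > real (k + 2) * d}
      \<le> ennreal (D * b k)" for k
  proof -
    \<comment> \<open>The height \<open>real (k + 2) * d\<close> is
      \<open>real (Suc (k + 1)) * d\<close>, hence the decay index \<open>k + 1\<close>; the weak
      bound is then used only at height \<open>d\<close>.\<close>
    have "2 ^ (k + 1) * emeasure lebesgue {x. \<bar>f x\<bar> > real (k + 2) * d} \<le> emeasure lebesgue {x. \<bar>f x\<bar> > d}"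
      using decay[of "k + 1"] by simp
    also have "\<dots> \<le> ennreal (M / d powr p)"
      using \<open>0 < d\<close> by (rule weak)
    also have "\<dots> = 2 ^ (k + 1) * ennreal (M / d powr p * (1 / 2) ^ (k + 1))"
    proof -
      have "2 ^ (k + 1) = ennreal (2 ^ (k + 1))"
        by (metis ennreal_numeral ennreal_power zero_le_numeral)
      moreover have "M / d powr p = 2 ^ (k + 1) * (M / d powr p * (1 / 2) ^ (k + 1))"
        by (simp add: power_one_over)
      ultimately show ?thesis
        using \<open>0 \<le> M\<close> by (metis ennreal_mult' zero_le_numeral zero_le_power)
    qed
    finally have "emeasure lebesgue {x. \<bar>f x\<bar> > real (k + 2) * d} \<le> ennreal (M / d powr p * (1 / 2) ^ (k + 1))"
      by (subst (asm) ennreal_mult_le_mult_iff) (auto simp: power_eq_top_ennreal ennreal_mult_eq_top_iff)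
    then have "ennreal ((real (k + 3) * d) powr q) * emeasure lebesgue {x. \<bar>f x\<bar> > real (k + 2) * d}
        \<le> ennreal ((real (k + 3) * d) powr q) * ennreal (M / d powr p * (1 / 2) ^ (k + 1))"
      by (rule mult_left_mono) simp
    also have "\<dots> = ennreal ((real (k + 3) * d) powr q * (M / d powr p * (1 / 2) ^ (k + 1)))"
      using \<open>0 \<le> M\<close> by (intro ennreal_mult[symmetric]) auto
    also have "(real (k + 3) * d) powr q * (M / d powr p * (1 / 2) ^ (k + 1)) = D * b k"
      using \<open>0 < d\<close> by (subst powr_mult) (auto simp: D_def b_def powr_diff)
    finally show ?thesis .
  qed
  have "(\<integral>\<^sup>+x. ennreal (\<bar>f x\<bar> powr q) \<partial>lebesgue) \<le> (\<Sum>j. ennreal (D * a j)) + (\<Sum>k. ennreal (D * b k))"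
    using \<open>0 < p\<close> \<open>p < q\<close>
    by (intro order.trans[OF nn_integral_powr_le_level_sets[OF f \<open>0 < d\<close>]] add_mono suminf_le 1 2) auto
  also have "\<dots> = ennreal (D * level_const p q)"
  proof -
    have "level_const p q = suminf a + suminf b"
      unfolding level_const_def a_def b_def ..
    then show ?thesis
      unfolding sum_ennreal[OF a ab(1)] sum_ennreal[OF b ab(2)]
      using \<open>0 \<le> D\<close> suminf_nonneg[OF a ab(1)] suminf_nonneg[OF b ab(2)]
      by (simp add: distrib_left flip: ennreal_plus)
  qed
  finally show ?thesis by (simp add: D_def)
qed

section \<open>Choice of scales and passage to the limit\<close>

lemma VMO_uniform_osc:
  fixes u :: "real ^ 'n \<Rightarrow> real"
  assumes "u \<in> VMO" "0 < e"
  obtains R where "0 < R" "\<And>C. is_cube C \<Longrightarrow> diameter C \<le> R \<Longrightarrow> mean_osc u C \<le> ennreal e"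
proof -
  let ?m = "\<lambda>R. SUP C\<in>{C. is_cube C \<and> diameter C \<le> R}. mean_osc u C"
  have "(?m \<longlongrightarrow> 0) (at_right 0)"
    using assms(1) by (simp add: VMO_def)
  then have "eventually (\<lambda>R. ?m R < ennreal e) (at_right 0)"
    using assms(2) by (intro order_tendstoD(2)) auto
  moreover have "eventually (\<lambda>R::real. 0 < R) (at_right 0)"
    by (rule eventually_at_right_less)
  ultimately obtain R where R: "0 < R" "?m R < ennreal e"
    using eventually_happens'[OF trivial_limit_at_right_real eventually_conj] by blast
  have "mean_osc u C \<le> ennreal e" if "is_cube C" "diameter C \<le> R" for C
  proof -
    have "mean_osc u C \<le> ?m R"
      using that by (intro SUP_upper) auto
    then show ?thesis using R(2) by simp
  qed
  then show thesis using that R(1) by blast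
qed

theorem theorem1p17:
  fixes u :: "real ^ 'n \<Rightarrow> real" and p q s :: real
  assumes "0 < p" and "p < q" and "0 < s" and "s < 1"
    and "u \<in> weak_Besov s p \<inter> VMO"
  shows "((\<lambda>h. \<integral>\<^sup>+x. ennreal (\<bar>u (x + h) - u x\<bar> powr q / norm h powr (s * p)) \<partial>lebesgue)
            \<longlongrightarrow> 0) (at 0)"
proof (rule order_tendstoI)
  fix \<epsilon> :: ennreal assume "0 < \<epsilon>"
  \<comment> \<open>A real tolerance below \<open>\<epsilon>\<close>, which may be
    \<open>top\<close>. The choices then run in the order \<open>e\<close>, \<open>d\<close>,
    \<open>R\<close>, \<open>h\<close>.\<close>
  then obtain e where e: "0 < e" "ennreal e < \<epsilon>"
    by (metis ennreal_less_zero_iff ennreal_cases dense not_less_iff_gr_or_eq top.not_eq_extremum)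
  have u: "u \<in> borel_measurable lebesgue"
    using assms(5) by (simp add: weak_Besov_def weak_Lp_def)
  obtain A where A: "0 < A" "\<And>h t. h \<noteq> 0 \<Longrightarrow> 0 < t \<Longrightarrow>
      emeasure lebesgue {x. \<bar>u (x + h) - u x\<bar> > t} \<le> ennreal (A * norm h powr (s * p) / t powr p)"
    using weak_Besov_level_set[of u s p] assms by blast
  \<comment> \<open>As \<open>q - p\<close> is positive, the final bound, which is free of
    \<open>h\<close>, tends to 0 with \<open>d\<close>.\<close>
  have "((\<lambda>d. A * d powr (q - p) * level_const p q) \<longlongrightarrow> A * 0 powr (q - p) * level_const p q) (at_right 0)"
    using \<open>p < q\<close> by (intro tendsto_mult tendsto_const tendsto_powr2 tendsto_ident_at)
      (auto simp: eventually_at_right_less intro!: eventually_mono[OF eventually_at_right_less])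
  then have "eventually (\<lambda>d. A * d powr (q - p) * level_const p q < e) (at_right 0)"
    using e(1) by (intro order_tendstoD(2)) auto
  moreover have "eventually (\<lambda>d::real. 0 < d) (at_right 0)"
    by (rule eventually_at_right_less)
  ultimately obtain d where d: "0 < d" "A * d powr (q - p) * level_const p q < e"
    using eventually_happens'[OF trivial_limit_at_right_real eventually_conj] by blast
  obtain R where R: "0 < R" "\<And>C. is_cube C \<Longrightarrow> diameter C \<le> R \<Longrightarrow>
      mean_osc u C \<le> ennreal (d / 2 ^ (CARD('n) + 4))"
    using VMO_uniform_osc[of u "d / 2 ^ (CARD('n) + 4)"] assms(5) d(1) by auto
  \<comment> \<open>Cubes of side at most \<open>r\<close> then have diameter at most
    \<open>R\<close>.\<close>
  define r where "r = R / real CARD('n)"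
  have r: "0 < r" "real CARD('n) * r = R"
    using R(1) by (auto simp: r_def)
  \<comment> \<open>With \<open>d\<close> and \<open>r\<close> fixed, the weak Besov bound at height
    \<open>d\<close> vanishes as \<open>h\<close> tends to 0, since \<open>s * p\<close> is
    positive; this yields the smallness that starts the decay.\<close>
  have "((\<lambda>h::real ^ 'n. 2 ^ (CARD('n) + 1) * (A * norm h powr (s * p) / d powr p)) \<longlongrightarrow>
      2 ^ (CARD('n) + 1) * (A * norm (0::real ^ 'n) powr (s * p) / d powr p)) (at 0)"
    using \<open>0 < d\<close> \<open>0 < s\<close> \<open>0 < p\<close> by (intro tendsto_intros tendsto_powr2) auto
  then have "eventually (\<lambda>h::real ^ 'n. 2 ^ (CARD('n) + 1) * (A * norm h powr (s * p) / d powr p) < r ^ CARD('n)) (at 0)"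
    using r(1) by (intro order_tendstoD(2)) auto
  moreover have "eventually (\<lambda>h::real ^ 'n. h \<noteq> 0) (at 0)"
    by (simp add: eventually_at_filter)
  ultimately show "\<forall>\<^sub>F h in at 0. (\<integral>\<^sup>+x. ennreal (\<bar>u (x + h) - u x\<bar> powr q / norm h powr (s * p)) \<partial>lebesgue) < \<epsilon>"
  proof eventually_elim
    case (elim h)
    define N where "N = norm h powr (s * p)"
    have "0 < N" using elim by (simp add: N_def)
    let ?f = "\<lambda>x. u (x + h) - u x"
    have f: "?f \<in> borel_measurable lebesgue"
      by (rule increment_measurable[OF u])
    have "2 ^ (CARD('n) + 1) * emeasure lebesgue {x. \<bar>?f x\<bar> > d}
        \<le> 2 ^ (CARD('n) + 1) * ennreal (A * N / d powr p)"
      unfolding N_def using A(2) elim d(1) by (intro mult_left_mono) auto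
    also have "\<dots> = ennreal (2 ^ (CARD('n) + 1) * (A * N / d powr p))"
      by (metis ennreal_mult' ennreal_numeral ennreal_power zero_le_numeral zero_le_power)
    also have "\<dots> \<le> ennreal (r ^ CARD('n))"
      using elim by (intro ennreal_leI) (simp add: N_def)
    finally have small: "2 ^ (CARD('n) + 1) * emeasure lebesgue {x. \<bar>?f x\<bar> > d} \<le> ennreal (r ^ CARD('n))" .
    have decay: "2 ^ k * emeasure lebesgue {x. \<bar>?f x\<bar> > real (Suc k) * d} \<le> emeasure lebesgue {x. \<bar>?f x\<bar> > d}" for k
      using small R(2) by (intro level_set_geometric_decay[OF u r(1) d(1)]) (auto simp: r(2))
    have bound: "(\<integral>\<^sup>+x. ennreal (\<bar>?f x\<bar> powr q) \<partial>lebesgue) \<le> ennreal (A * N * d powr (q - p) * level_const p q)"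
    proof (rule nn_integral_powr_le_of_decay[OF f d(1) assms(1,2) _ _ decay])
      show "0 \<le> A * N" using A(1) \<open>0 < N\<close> by simp
      show "emeasure lebesgue {x. \<bar>?f x\<bar> > t} \<le> ennreal (A * N / t powr p)" if "0 < t" for t
        unfolding N_def using A(2) elim that by blast
    qed
    \<comment> \<open>The normalising factor \<open>1 / N\<close> cancels the \<open>N\<close>
      supplied by the Besov bound.\<close>
    have "(\<integral>\<^sup>+x. ennreal (\<bar>?f x\<bar> powr q / N) \<partial>lebesgue)
        = (\<integral>\<^sup>+x. ennreal (1 / N) * ennreal (\<bar>?f x\<bar> powr q) \<partial>lebesgue)"
      using \<open>0 < N\<close> by (intro nn_integral_cong) (simp flip: ennreal_mult'')
    also have "\<dots> = ennreal (1 / N) * (\<integral>\<^sup>+x. ennreal (\<bar>?f x\<bar> powr q) \<partial>lebesgue)"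
      by (intro nn_integral_cmult measurable_compose[OF f]) measurable
    also have "\<dots> \<le> ennreal (1 / N) * ennreal (A * N * d powr (q - p) * level_const p q)"
      using bound by (intro mult_left_mono) auto
    also have "\<dots> = ennreal (A * d powr (q - p) * level_const p q)"
      using \<open>0 < N\<close> by (simp add: field_simps flip: ennreal_mult')
    also have "\<dots> \<le> ennreal e"
      using d(2) by (intro ennreal_leI) simp
    also note e(2)
    finally show ?case by (simp add: N_def)
  qed
qed simp

end
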